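(* For any Tychonov space $X$ we have $\pi sw(X) \le p\,\pi\chi(X)$. In particular, any Tychonov space $X$ of countable projective $\pi$-character (i.e. with $p\,\pi\chi(X)\le\omega$) has a point-countable $\pi$-base, that is, a $\pi$-base $\mathcal{B}$ such that every point of $X$ belongs to at most countably many members of $\mathcal{B}$.
   Context: A Tychonov space is a completely regular Hausdorff space. As usual for topological cardinal functions, values are taken to be infinite cardinals (finite values are replaced by $\omega$). A $\pi$-base of a space $X$ is a family $\mathcal{B}$ of non-empty open subsets of $X$ such that every non-empty open subset of $X$ contains a member of $\mathcal{B}$. A family $\mathcal{B}$ has order at most $\lambda$ if every point of $X$ is contained in at most $\lambda$ members of $\mathcal{B}$. The $\pi$-separating weight $\pi sw(X)$ is the minimum order of a $\pi$-base of $X$, i.e. the least infinite cardinal $\lambda$ such that $X$ has a $\pi$-base of order at most $\lambda$. For a point $y$ of a space $Y$, a local $\pi$-base at $y$ in $Y$ is a family of non-empty open subsets of $Y$ such that every neighbourhood of $y$ contains a member of the family; $\pi\chi(y,Y)$ is the minimum cardinality of a local $\pi$-base at $y$ in $Y$, and $\pi\chi(Y)=\sup\{\pi\chi(y,Y): y\in Y\}$ is the $\pi$-character of $Y$. The projective $\pi$-character $p\,\pi\chi(X)$ of a Tychonov space $X$ is the supremum of the values $\pi\chi(Y)$ where $Y$ ranges over all Tychonov spaces that are continuous images of $X$. *)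

theory Defs
  imports "HOL-Analysis.Analysis"
begin

unbundle cardinal_syntax

text \<open>Cardinals are rendered as cardinal orders (\<^const>\<open>Card_order\<close>), compared by \<^const>\<open>ordLeq\<close>;
  they are unique only up to \<^const>\<open>ordIso\<close>, hence the choice operator in the definition of the
  least infinite cardinal with a given property.\<close>

definition least_cardinal :: "('k rel \<Rightarrow> bool) \<Rightarrow> 'k rel"
  where "least_cardinal P =
    (SOME r. Cinfinite r \<and> P r \<and> (\<forall>s. Cinfinite s \<and> P s \<longrightarrow> r \<le>o s))"

definition sup_cardinal :: "'k rel set \<Rightarrow> 'k rel"
  where "sup_cardinal R = least_cardinal (\<lambda>r. \<forall>s\<in>R. s \<le>o r)"

text \<open>The cardinal functions of a topology on \<open>'a\<close> take values in the cardinals on the type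
  \<open>'a set + nat\<close>. This type is infinite and at least as large as any family of open sets, so
  the minima and suprema below are attained in it; see the lemmas at the end of the theory.\<close>

type_synonym 'a cardinal = "('a set + nat) rel"

definition Tychonov_space :: "'a topology \<Rightarrow> bool"
  where "Tychonov_space X \<longleftrightarrow> completely_regular_space X \<and> Hausdorff_space X"

definition pi_base :: "'a topology \<Rightarrow> 'a set set \<Rightarrow> bool"
  where "pi_base X \<B> \<longleftrightarrow>
    (\<forall>B\<in>\<B>. openin X B \<and> B \<noteq> {}) \<and>
    (\<forall>U. openin X U \<and> U \<noteq> {} \<longrightarrow> (\<exists>B\<in>\<B>. B \<subseteq> U))"

definition order_at_most :: "'a topology \<Rightarrow> 'a set set \<Rightarrow> 'k rel \<Rightarrow> bool"
  where "order_at_most X \<B> r \<longleftrightarrow> (\<forall>x\<in>topspace X. |{B\<in>\<B>. x \<in> B}| \<le>o r)"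

definition pi_sw :: "'a topology \<Rightarrow> 'a cardinal"
  where "pi_sw X = least_cardinal (\<lambda>r. \<exists>\<B>. pi_base X \<B> \<and> order_at_most X \<B> r)"

definition local_pi_base :: "'a topology \<Rightarrow> 'a \<Rightarrow> 'a set set \<Rightarrow> bool"
  where "local_pi_base Y y \<B> \<longleftrightarrow>
    (\<forall>B\<in>\<B>. openin Y B \<and> B \<noteq> {}) \<and>
    (\<forall>U. openin Y U \<and> y \<in> U \<longrightarrow> (\<exists>B\<in>\<B>. B \<subseteq> U))"

definition pi_char_at :: "'a \<Rightarrow> 'a topology \<Rightarrow> 'a cardinal"
  where "pi_char_at y Y = least_cardinal (\<lambda>r. \<exists>\<B>. local_pi_base Y y \<B> \<and> |\<B>| \<le>o r)"

definition pi_char :: "'a topology \<Rightarrow> 'a cardinal"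
  where "pi_char Y = sup_cardinal ((\<lambda>y. pi_char_at y Y) ` topspace Y)"

definition continuous_image_of :: "'b topology \<Rightarrow> 'a topology \<Rightarrow> bool"
  where "continuous_image_of Y X \<longleftrightarrow>
    (\<exists>f. continuous_map X Y f \<and> f ` topspace X = topspace Y)"

text \<open>HOL cannot quantify over types inside a definition, so the supremum is taken over the images
  \<open>Y\<close> whose points lie in the type \<open>'a\<close> of the points of \<open>X\<close>. Up to homeomorphism these are all
  continuous images; lemma \<open>pi_char_le_proj_pi_char\<close> below shows that the supremum
  bounds the images over every type.\<close>

definition proj_pi_char :: "'a topology \<Rightarrow> 'a cardinal"
  where "proj_pi_char X =
    sup_cardinal {pi_char Y |Y :: 'a topology. Tychonov_space Y \<and> continuous_image_of Y X}"


subsection \<open>The minima and suprema exist\<close>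

lemma least_cardinal:
  assumes "Cinfinite r" "P r"
  shows Cinfinite_least_cardinal: "Cinfinite (least_cardinal P)"
    and least_cardinal_attained: "P (least_cardinal P)"
    and least_cardinal_least: "\<And>s. Cinfinite s \<Longrightarrow> P s \<Longrightarrow> least_cardinal P \<le>o s"
proof -
  let ?Q = "\<lambda>r. Cinfinite r \<and> P r \<and> (\<forall>s. Cinfinite s \<and> P s \<longrightarrow> r \<le>o s)"
  have "r \<in> {r. Cinfinite r \<and> P r}" using assms by simp
  then obtain m where m: "m \<in> {r. Cinfinite r \<and> P r}"
      "\<And>s. (s, m) \<in> ordLess \<Longrightarrow> s \<notin> {r. Cinfinite r \<and> P r}"
    by (rule wfE_min[OF wf_ordLess]) blast
  have "m \<le>o s" if "Cinfinite s" "P s" for s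
  proof -
    have "\<not> s <o m" using m(2) that by blast
    moreover have "Well_order s" "Well_order m" using that m(1) card_order_on_well_order_on by blast+
    ultimately show ?thesis using not_ordLess_iff_ordLeq by blast
  qed
  then have "?Q m" using m(1) by blast
  then have "?Q (least_cardinal P)" unfolding least_cardinal_def by (rule someI)
  then show "Cinfinite (least_cardinal P)" "P (least_cardinal P)"
    "\<And>s. Cinfinite s \<Longrightarrow> P s \<Longrightarrow> least_cardinal P \<le>o s"
    by blast+
qed

lemma Cinfinite_card_of_UNIV: "Cinfinite |UNIV :: ('a set + nat) set|"
  by (simp add: cinfinite_def Field_card_of card_of_card_order_on)

lemma card_of_sets_le_UNIV: "|\<B> :: 'a set set| \<le>o |UNIV :: ('a set + nat) set|"
  by (intro card_of_ordLeqI[where f = Inl]) auto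

lemma Card_order_le_UNIV:
  assumes "Card_order (r :: 'k rel)" shows "r \<le>o |UNIV :: 'k set|"
  by (rule ordIso_ordLeq_trans[OF ordIso_symmetric[OF card_of_Field_ordIso[OF assms]] card_of_mono1])
    simp

lemma sup_cardinal:
  assumes "\<And>s. s \<in> R \<Longrightarrow> Card_order s"
  shows Cinfinite_sup_cardinal: "Cinfinite (sup_cardinal R :: 'a cardinal)"
    and sup_cardinal_upper: "s \<in> R \<Longrightarrow> s \<le>o sup_cardinal R"
    and sup_cardinal_least: "Cinfinite (t :: 'b rel) \<Longrightarrow> (\<And>s. s \<in> R \<Longrightarrow> s \<le>o t) \<Longrightarrow> sup_cardinal R \<le>o t"
proof -
  let ?U = "|UNIV :: ('a set + nat) set|"
  have *: "\<forall>s\<in>R. s \<le>o ?U" using assms Card_order_le_UNIV by blast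
  note L = least_cardinal[of ?U "\<lambda>r. \<forall>s\<in>R. s \<le>o r", OF Cinfinite_card_of_UNIV *,
    folded sup_cardinal_def]
  show "Cinfinite (sup_cardinal R)" by (rule L(1))
  show "s \<in> R \<Longrightarrow> s \<le>o sup_cardinal R" using L(2) by blast
  show "sup_cardinal R \<le>o t" if t: "Cinfinite t" and le: "\<And>s. s \<in> R \<Longrightarrow> s \<le>o t"
  proof (cases "t \<le>o ?U")
    case True
    obtain p :: "'a cardinal" where p: "(t, p) \<in> ordIso"
      using iffD1[OF internalize_ordLeq True] by (elim exE conjE)
    have "Cinfinite p" by (rule Cinfinite_cong[OF p t])
    moreover have "\<forall>s\<in>R. s \<le>o p" by (intro ballI ordLeq_ordIso_trans[OF le p])
    ultimately have "sup_cardinal R \<le>o p" by (rule L(3))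
    then show ?thesis by (rule ordLeq_ordIso_trans[OF _ ordIso_symmetric[OF p]])
  next
    case False
    have "?U \<le>o t"
      using False ordLeq_total[OF card_of_Well_order card_order_on_well_order_on[OF conjunct2[OF t]]]
      by blast
    moreover have "sup_cardinal R \<le>o ?U" by (rule Card_order_le_UNIV[OF conjunct2[OF L(1)]])
    ultimately show ?thesis by (rule ordLeq_transitive[rotated])
  qed
qed

lemma pi_sw:
  fixes X :: "'a topology"
  shows Cinfinite_pi_sw: "Cinfinite (pi_sw X)"
    and pi_sw_attained: "\<exists>\<B>. pi_base X \<B> \<and> order_at_most X \<B> (pi_sw X)"
    and pi_sw_least: "pi_base X \<B> \<Longrightarrow> Cinfinite (t :: 'b rel) \<Longrightarrow> order_at_most X \<B> t \<Longrightarrow> pi_sw X \<le>o t"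
proof -
  let ?U = "|UNIV :: ('a set + nat) set|"
  have "pi_base X {U. openin X U \<and> U \<noteq> {}}" by (auto simp: pi_base_def)
  then have *: "\<exists>\<B>. pi_base X \<B> \<and> order_at_most X \<B> ?U"
    using card_of_sets_le_UNIV by (auto simp: order_at_most_def)
  note L = least_cardinal[of ?U "\<lambda>r. \<exists>\<B>. pi_base X \<B> \<and> order_at_most X \<B> r",
    OF Cinfinite_card_of_UNIV *, folded pi_sw_def]
  show "Cinfinite (pi_sw X)" by (rule L(1))
  show "\<exists>\<B>. pi_base X \<B> \<and> order_at_most X \<B> (pi_sw X)" by (rule L(2))
  show "pi_sw X \<le>o t" if B: "pi_base X \<B>" and t: "Cinfinite t" and o: "order_at_most X \<B> t"
  proof (cases "t \<le>o ?U")
    case True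
    obtain p :: "'a cardinal" where p: "(t, p) \<in> ordIso"
      using iffD1[OF internalize_ordLeq True] by (elim exE conjE)
    have "Cinfinite p" by (rule Cinfinite_cong[OF p t])
    moreover have "order_at_most X \<B> p"
      using o unfolding order_at_most_def by (intro ballI ordLeq_ordIso_trans[OF _ p]) (rule bspec)
    ultimately have "pi_sw X \<le>o p" using B by (intro L(3)) blast+
    then show ?thesis by (rule ordLeq_ordIso_trans[OF _ ordIso_symmetric[OF p]])
  next
    case False
    have "?U \<le>o t"
      using False ordLeq_total[OF card_of_Well_order card_order_on_well_order_on[OF conjunct2[OF t]]]
      by blast
    moreover have "pi_sw X \<le>o ?U" by (rule Card_order_le_UNIV[OF conjunct2[OF L(1)]])
    ultimately show ?thesis by (rule ordLeq_transitive[rotated])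
  qed
qed

lemma pi_char_at:
  fixes Y :: "'a topology"
  shows Cinfinite_pi_char_at: "Cinfinite (pi_char_at y Y)"
    and pi_char_at_attained: "\<exists>\<B>. local_pi_base Y y \<B> \<and> |\<B>| \<le>o pi_char_at y Y"
    and pi_char_at_least: "local_pi_base Y y \<B> \<Longrightarrow> Cinfinite (t :: 'b rel) \<Longrightarrow> |\<B>| \<le>o t \<Longrightarrow> pi_char_at y Y \<le>o t"
proof -
  let ?U = "|UNIV :: ('a set + nat) set|"
  have "local_pi_base Y y {U. openin Y U \<and> U \<noteq> {}}" by (auto simp: local_pi_base_def)
  then have *: "\<exists>\<B>. local_pi_base Y y \<B> \<and> |\<B>| \<le>o ?U"
    using card_of_sets_le_UNIV by blast
  note L = least_cardinal[of ?U "\<lambda>r. \<exists>\<B>. local_pi_base Y y \<B> \<and> |\<B>| \<le>o r",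
    OF Cinfinite_card_of_UNIV *, folded pi_char_at_def]
  show "Cinfinite (pi_char_at y Y)" by (rule L(1))
  show "\<exists>\<B>. local_pi_base Y y \<B> \<and> |\<B>| \<le>o pi_char_at y Y" by (rule L(2))
  show "pi_char_at y Y \<le>o t" if B: "local_pi_base Y y \<B>" and t: "Cinfinite t" "|\<B>| \<le>o t"
  proof -
    let ?p = "|\<B> <+> (UNIV :: nat set)|"
    have "Cinfinite ?p" by (simp add: cinfinite_def Field_card_of card_of_card_order_on)
    moreover have "|\<B>| \<le>o ?p" by (rule card_of_Plus1)
    ultimately have "pi_char_at y Y \<le>o ?p" using B by (intro L(3)) blast+
    moreover have "|UNIV :: nat set| \<le>o t"
      using t(1) ordLeq_ordIso_trans[OF iffD1[OF infinite_iff_card_of_nat] card_of_Field_ordIso]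
      unfolding cinfinite_def by blast
    then have "?p \<le>o t"
      using t by (intro card_of_Plus_ordLeq_infinite_Field) (auto simp: cinfinite_def)
    ultimately show ?thesis by (rule ordLeq_transitive)
  qed
qed

lemma pi_char:
  fixes Y :: "'a topology"
  shows Cinfinite_pi_char: "Cinfinite (pi_char Y)"
    and pi_char_upper: "y \<in> topspace Y \<Longrightarrow> pi_char_at y Y \<le>o pi_char Y"
    and pi_char_least: "Cinfinite (t :: 'b rel) \<Longrightarrow> (\<And>y. y \<in> topspace Y \<Longrightarrow> pi_char_at y Y \<le>o t) \<Longrightarrow> pi_char Y \<le>o t"
proof -
  have c: "Card_order s" if "s \<in> (\<lambda>y. pi_char_at y Y) ` topspace Y" for s
  proof -
    from that obtain y where "s = pi_char_at y Y" by auto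
    then show ?thesis using Cinfinite_pi_char_at[of y Y] by simp
  qed
  show "Cinfinite (pi_char Y)"
    unfolding pi_char_def by (rule Cinfinite_sup_cardinal[OF c])
  show "y \<in> topspace Y \<Longrightarrow> pi_char_at y Y \<le>o pi_char Y"
    unfolding pi_char_def by (rule sup_cardinal_upper[OF c]) auto
  show "Cinfinite t \<Longrightarrow> (\<And>y. y \<in> topspace Y \<Longrightarrow> pi_char_at y Y \<le>o t) \<Longrightarrow> pi_char Y \<le>o t"
    unfolding pi_char_def by (rule sup_cardinal_least[OF c]) auto
qed


subsection \<open>The projective \<open>\<pi>\<close>-character bounds the images over every type\<close>

lemma homeomorphic_map_local_pi_base:
  assumes h: "homeomorphic_map Y Z h" and y: "y \<in> topspace Y" and B: "local_pi_base Y y \<B>"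
  shows "local_pi_base Z (h y) ((`) h ` \<B>)"
  unfolding local_pi_base_def
proof (intro conjI ballI allI impI)
  fix C assume "C \<in> (`) h ` \<B>"
  then obtain D where D: "D \<in> \<B>" "C = h ` D" by blast
  then have "openin Y D" "D \<noteq> {}" using B unfolding local_pi_base_def by blast+
  then show "openin Z C" "C \<noteq> {}"
    using homeomorphic_map_openness[OF h openin_subset] D(2) by blast+
next
  fix U assume U: "openin Z U \<and> h y \<in> U"
  have "openin Y {x \<in> topspace Y. h x \<in> U}"
    using openin_continuous_map_preimage[OF homeomorphic_imp_continuous_map[OF h]] U by blast
  then obtain C where "C \<in> \<B>" "C \<subseteq> {x \<in> topspace Y. h x \<in> U}"
    using B U y unfolding local_pi_base_def by blast
  then show "\<exists>C\<in>(`) h ` \<B>. C \<subseteq> U" by blast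
qed

lemma pi_char_homeomorphic_le:
  fixes Y :: "'a topology" and Z :: "'b topology"
  assumes h: "homeomorphic_map Y Z h"
  shows "pi_char Z \<le>o pi_char Y"
proof (rule pi_char_least[OF Cinfinite_pi_char])
  fix z assume "z \<in> topspace Z"
  then obtain y where y: "y \<in> topspace Y" "z = h y"
    using homeomorphic_imp_surjective_map[OF h] by blast
  obtain \<B> where B: "local_pi_base Y y \<B>" "|\<B>| \<le>o pi_char_at y Y"
    using pi_char_at_attained[of Y y] by (elim exE conjE)
  have "|(`) h ` \<B>| \<le>o pi_char Y"
    by (rule ordLeq_transitive[OF card_of_image ordLeq_transitive[OF B(2) pi_char_upper[OF y(1)]]])
  then show "pi_char_at z Z \<le>o pi_char Y"
    unfolding y(2)
    by (rule pi_char_at_least[OF homeomorphic_map_local_pi_base[OF h y(1) B(1)] Cinfinite_pi_char])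
qed

lemma proj_pi_char:
  fixes X :: "'a topology"
  shows Cinfinite_proj_pi_char: "Cinfinite (proj_pi_char X)"
    and proj_pi_char_upper: "Tychonov_space (Y :: 'a topology) \<Longrightarrow> continuous_image_of Y X \<Longrightarrow>
      pi_char Y \<le>o proj_pi_char X"
    and proj_pi_char_least: "Cinfinite (t :: 'b rel) \<Longrightarrow>
      (\<And>Y :: 'a topology. Tychonov_space Y \<Longrightarrow> continuous_image_of Y X \<Longrightarrow> pi_char Y \<le>o t) \<Longrightarrow>
      proj_pi_char X \<le>o t"
proof -
  let ?R = "{pi_char Y |Y :: 'a topology. Tychonov_space Y \<and> continuous_image_of Y X}"
  have c: "Card_order s" if "s \<in> ?R" for s
  proof -
    from that obtain Y :: "'a topology" where "s = pi_char Y" by auto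
    then show ?thesis using Cinfinite_pi_char[of Y] by simp
  qed
  show "Cinfinite (proj_pi_char X)"
    unfolding proj_pi_char_def by (rule Cinfinite_sup_cardinal[OF c])
  show "Tychonov_space Y \<Longrightarrow> continuous_image_of Y X \<Longrightarrow> pi_char Y \<le>o proj_pi_char X" for Y :: "'a topology"
    unfolding proj_pi_char_def by (rule sup_cardinal_upper[OF c]) auto
  show "Cinfinite t \<Longrightarrow>
      (\<And>Y :: 'a topology. Tychonov_space Y \<Longrightarrow> continuous_image_of Y X \<Longrightarrow> pi_char Y \<le>o t) \<Longrightarrow>
      proj_pi_char X \<le>o t"
    unfolding proj_pi_char_def by (rule sup_cardinal_least[OF c]) auto
qed

lemma pi_char_le_proj_pi_char:
  fixes X :: "'a topology" and Y :: "'b topology"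
  assumes Y: "Tychonov_space Y" and im: "continuous_image_of Y X"
  shows "pi_char Y \<le>o proj_pi_char X"
proof -
  obtain f where f: "continuous_map X Y f" "f ` topspace X = topspace Y"
    using im by (auto simp: continuous_image_of_def)
  define g where "g = inv_into (topspace X) f"
  have g: "g y \<in> topspace X" "f (g y) = y" if "y \<in> topspace Y" for y
    using that f(2) by (auto simp: g_def inv_into_into f_inv_into_f)
  define Z where "Z = pullback_topology (g ` topspace Y) f Y"
  have tZ: "topspace Z = g ` topspace Y"
    using g by (auto simp: Z_def topspace_pullback_topology)
  have cf: "continuous_map Z Y f"
    unfolding continuous_map_def
  proof (intro conjI allI impI)
    show "f \<in> topspace Z \<rightarrow> topspace Y" using g tZ by auto
    fix U assume "openin Y U"
    then show "openin Z {x \<in> topspace Z. f x \<in> U}"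
      unfolding tZ unfolding Z_def openin_pullback_topology by blast
  qed
  have cg: "continuous_map Y Z g"
    unfolding continuous_map_def
  proof (intro conjI allI impI)
    show "g \<in> topspace Y \<rightarrow> topspace Z" using tZ by auto
    fix U assume "openin Z U"
    then obtain V where V: "openin Y V" "U = f -` V \<inter> g ` topspace Y"
      unfolding Z_def openin_pullback_topology by blast
    have "{x \<in> topspace Y. g x \<in> U} = V"
    proof (intro subset_antisym subsetI)
      fix x assume "x \<in> {x \<in> topspace Y. g x \<in> U}"
      then have "x \<in> topspace Y" "f (g x) \<in> V" using V(2) by blast+
      then show "x \<in> V" using g(2) by simp
    next
      fix x assume "x \<in> V"
      then show "x \<in> {x \<in> topspace Y. g x \<in> U}"
        using V openin_subset[OF V(1)] g(2) by auto
    qed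
    then show "openin Y {x \<in> topspace Y. g x \<in> U}" using V(1) by simp
  qed
  have hm: "homeomorphic_maps Z Y f g"
    unfolding homeomorphic_maps_def using cf cg g tZ by auto
  have sp: "Z homeomorphic_space Y"
    using hm by (auto simp: homeomorphic_space_def)
  have "Tychonov_space Z"
    using Y homeomorphic_completely_regular_space[OF sp] homeomorphic_Hausdorff_space[OF sp]
    unfolding Tychonov_space_def by blast
  moreover have "continuous_image_of Z X"
    unfolding continuous_image_of_def
  proof (intro exI conjI)
    show "continuous_map X Z (g \<circ> f)" using f(1) cg by (rule continuous_map_compose)
    show "(g \<circ> f) ` topspace X = topspace Z" using f(2) tZ by (metis image_comp)
  qed
  ultimately have "pi_char Z \<le>o proj_pi_char X" by (rule proj_pi_char_upper)
  moreover have "homeomorphic_map Z Y f" using hm homeomorphic_map_maps by blast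
  then have "pi_char Y \<le>o pi_char Z" by (rule pi_char_homeomorphic_le)
  ultimately show ?thesis by (rule ordLeq_transitive[rotated])
qed

end

theory Submission
  imports Defs "HOL-Library.Countable_Set_Type"
begin

text \<open>Let \<open>\<kappa> = proj_pi_char X\<close>. By Zorn's lemma, it suffices to find a \<open>\<pi>\<close>-base of order at most \<open>\<kappa>\<close>
  for every open \<open>G\<close> all of whose non-empty open subsets have the same \<open>\<pi>\<close>-weight \<open>\<lambda>\<close>, where we may
  assume \<open>\<kappa> < \<lambda>\<close>. Enumerate a \<open>\<pi>\<close>-base of \<open>G\<close> in order type \<open>\<lambda>\<close> and choose recursively, inside the
  \<open>i\<close>-th member, a non-empty cozero set of a continuous \<open>f i\<close> that contains no non-empty finite
  intersection of preimages of rational intervals under the earlier functions; there are fewer than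
  \<open>\<lambda>\<close> such intersections, so they cannot form a \<open>\<pi>\<close>-base of the \<open>i\<close>-th member. If a point \<open>x\<close> were
  in more than \<open>\<kappa>\<close> of the cozero sets, map \<open>X\<close> to a product of lines by a family \<open>S\<close> of the
  corresponding functions of which every subfamily of size \<open>\<kappa>\<close> is bounded in \<open>S\<close>. A local \<open>\<pi>\<close>-base
  of size \<open>\<kappa>\<close> at the image of \<open>x\<close> then only involves functions before some member of \<open>S\<close>, whose
  cozero set contradicts its choice.\<close>

section \<open>Cardinal bounds and bounded subfamilies of a well-order\<close>

lemma finite_ordLeq_Cinfinite:
  assumes "Cinfinite r" "finite A"
  shows "|A| \<le>o r"
  using iffD1[OF countable_card_le_natLeq countable_finite[OF assms(2)]]
    natLeq_ordLeq_cinfinite[OF assms(1)]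
  by (rule ordLeq_transitive)

text \<open>Serves to count rational boxes over a given index set. Lists of fixed length are bounded
  by induction through products, and there are countably many lengths.\<close>

lemma card_of_lists_ordLeq:
  assumes r: "Cinfinite r" and A: "|A| \<le>o r"
  shows "|lists A| \<le>o r"
proof -
  have n: "|{l \<in> lists A. length l = n}| \<le>o r" for n
  proof (induction n)
    case 0
    have "{l \<in> lists A. length l = 0} \<subseteq> {[]}" by auto
    then show ?case by (intro finite_ordLeq_Cinfinite[OF r]) (rule finite_subset, auto)
  next
    case (Suc n)
    have "{l \<in> lists A. length l = Suc n} \<subseteq> (\<lambda>(a, l). a # l) ` (A \<times> {l \<in> lists A. length l = n})"
      by (force simp: length_Suc_conv)
    moreover have "|A \<times> {l \<in> lists A. length l = n}| \<le>o r"
      using r A Suc by (intro card_of_Times_ordLeq_infinite_Field) (auto simp: cinfinite_def)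
    ultimately show ?case
      by (rule ordLeq_transitive[OF card_of_mono1 ordLeq_transitive[OF card_of_image]])
  qed
  have "lists A = (\<Union>n. {l \<in> lists A. length l = n})" by auto
  moreover have "|\<Union>n. {l \<in> lists A. length l = n}| \<le>o r"
    using r n ordIso_ordLeq_trans[OF card_of_nat natLeq_ordLeq_cinfinite[OF r]]
    by (intro card_of_UNION_ordLeq_infinite_Field ballI) (simp_all add: cinfinite_def)
  ultimately show ?thesis by simp
qed

text \<open>If some initial segment of \<open>S\<close> exceeds \<open>k\<close>, cut
  \<open>S\<close> strictly below the least point where this happens; otherwise keep
  \<open>S\<close>. The result exceeds \<open>k\<close> while its initial segments do not. An
  unbounded \<open>T\<close> of size at most \<open>k\<close> would cover it by at most
  \<open>k\<close> such segments, which is impossible.\<close>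

lemma subset_with_small_subsets_bounded:
  assumes wo: "Well_order r" and S: "S \<subseteq> Field r" and k: "Cinfinite k" and large: "\<not> |S| \<le>o k"
  obtains S' where "S' \<subseteq> S" "\<And>T. T \<subseteq> S' \<Longrightarrow> |T| \<le>o k \<Longrightarrow> \<exists>a\<in>S'. T \<subseteq> underS r a"
proof -
  have wo_rel: "wo_rel r" using wo by (simp add: wo_rel_def)
  note REFL = wo_rel.REFL[OF wo_rel] and ANTISYM = wo_rel.ANTISYM[OF wo_rel]
    and TOTALS = wo_rel.TOTALS[OF wo_rel]
  have "\<exists>S'\<subseteq>S. \<not> |S'| \<le>o k \<and> (\<forall>a\<in>S'. |S' \<inter> under r a| \<le>o k)"
  proof (cases "\<forall>a\<in>S. |S \<inter> under r a| \<le>o k")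
    case True
    then show ?thesis using large by blast
  next
    case False
    let ?bad = "{a \<in> S. \<not> |S \<inter> under r a| \<le>o k}"
    obtain a where a: "a \<in> ?bad" and least: "\<And>b. b \<in> ?bad \<Longrightarrow> (a, b) \<in> r"
      using False S wo_rel.Well_order_isMinim_exists[OF wo_rel, of ?bad]
      unfolding wo_rel.isMinim_def[OF wo_rel] by blast
    \<comment> \<open>The closed and the strict segment differ in the point \<open>a\<close> only,
      so the strict one still exceeds \<open>k\<close>.\<close>
    have eq: "S \<inter> under r a = insert a (S \<inter> underS r a)"
      using a S REFL unfolding under_def underS_def refl_on_def by auto
    have "\<not> |S \<inter> underS r a| \<le>o k"
    proof
      assume "|S \<inter> underS r a| \<le>o k"
      then have "|{a} \<union> (S \<inter> underS r a)| \<le>o k"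
        using k finite_ordLeq_Cinfinite[OF k, of "{a}"]
        by (intro card_of_Un_ordLeq_infinite_Field) (auto simp: cinfinite_def)
      then show False using a eq by simp
    qed
    moreover have "|(S \<inter> underS r a) \<inter> under r b| \<le>o k" if "b \<in> S \<inter> underS r a" for b
    proof -
      have "(a, b) \<notin> r" using that ANTISYM unfolding underS_def antisym_def by blast
      then have "|S \<inter> under r b| \<le>o k" using least that by blast
      then show ?thesis by (rule ordLeq_transitive[OF card_of_mono1, rotated]) blast
    qed
    ultimately show ?thesis by blast
  qed
  then obtain S' where S': "S' \<subseteq> S" "\<not> |S'| \<le>o k" "\<And>a. a \<in> S' \<Longrightarrow> |S' \<inter> under r a| \<le>o k"
    by blast
  have "\<exists>a\<in>S'. T \<subseteq> underS r a" if T: "T \<subseteq> S'" "|T| \<le>o k" for T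
  proof (rule ccontr)
    assume neg: "\<not> ?thesis"
    have "S' \<subseteq> (\<Union>t\<in>T. S' \<inter> under r t)"
    proof
      fix a assume a: "a \<in> S'"
      then obtain t where "t \<in> T" "t \<notin> underS r a" using neg by blast
      moreover from this have "(a, t) \<in> r"
        using a T S'(1) S TOTALS unfolding underS_def by blast
      ultimately show "a \<in> (\<Union>t\<in>T. S' \<inter> under r t)" using a unfolding under_def by blast
    qed
    moreover have "|\<Union>t\<in>T. S' \<inter> under r t| \<le>o k"
      using k T S'(3) by (intro card_of_UNION_ordLeq_infinite_Field) (auto simp: cinfinite_def)
    ultimately have "|S'| \<le>o k" by (rule ordLeq_transitive[OF card_of_mono1])
    then show False using S'(2) by blast
  qed
  then show ?thesis using that S'(1) by blast
qed

section \<open>Boxes of rational intervals and images in products of lines\<close>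

text \<open>These are preimages of basic open sets of a product of lines. Coding them by lists makes
  each one depend on finitely many indices and lets them be counted. Rationality of the endpoints is
  imposed where the lists are drawn from \<open>S \<times> \<rat> \<times> \<rat>\<close>; the empty
  list gives the whole space.\<close>

definition rational_box :: "'a topology \<Rightarrow> ('i \<Rightarrow> 'a \<Rightarrow> real) \<Rightarrow> ('i \<times> real \<times> real) list \<Rightarrow> 'a set"
  where "rational_box X f l = {x \<in> topspace X. \<forall>(i, p, q)\<in>set l. p < f i x \<and> f i x < q}"

text \<open>Needed for the recursion: the condition on the function at \<open>i\<close> must depend
  on earlier functions only.\<close>

lemma rational_box_cong:
  assumes "\<And>i. i \<in> fst ` set l \<Longrightarrow> f i = g i"
  shows "rational_box X f l = rational_box X g l"
  using assms unfolding rational_box_def by force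

lemma openin_rational_box:
  assumes "\<And>i. i \<in> fst ` set l \<Longrightarrow> continuous_map X euclideanreal (f i)"
  shows "openin X (rational_box X f l)"
  using assms
proof (induction l)
  case Nil
  then show ?case by (simp add: rational_box_def)
next
  case (Cons t l)
  obtain i p q where t: "t = (i, p, q)" by (cases t)
  have "rational_box X f (t # l) = rational_box X f l \<inter> {x \<in> topspace X. f i x \<in> {p<..<q}}"
    by (auto simp: rational_box_def t)
  moreover have "openin X {x \<in> topspace X. f i x \<in> {p<..<q}}"
    by (rule openin_continuous_map_preimage[where Y = euclideanreal]) (use Cons.prems t in auto)
  ultimately show ?case using Cons by auto
qed

text \<open>A basic open set of the product restricts finitely many coordinates, and in each of them
  an interval with rational endpoints fits around the coordinate of \<open>x\<close>.\<close>

lemma rational_box_base: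
  assumes x: "x \<in> topspace X"
    and B: "openin (subtopology (product_topology (\<lambda>_. euclideanreal) S) (e ` topspace X)) B"
    and e: "e = (\<lambda>x. \<lambda>i\<in>S. f i x)" and xB: "e x \<in> B"
  shows "\<exists>l \<in> lists (S \<times> \<rat> \<times> \<rat>). x \<in> rational_box X f l \<and> e ` rational_box X f l \<subseteq> B"
proof -
  obtain V where V: "openin (product_topology (\<lambda>_. euclideanreal) S) V" "B = V \<inter> e ` topspace X"
    using B by (auto simp: openin_subtopology)
  have "e x \<in> V" using V(2) xB by blast
  from bspec[OF V(1)[unfolded openin_product_topology_alt] this] obtain U where U: "finite {i \<in> S. U i \<noteq> topspace euclideanreal}"
      "\<And>i. i \<in> S \<Longrightarrow> openin euclideanreal (U i)" "e x \<in> Pi\<^sub>E S U" "Pi\<^sub>E S U \<subseteq> V"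
    by blast
  have "\<exists>p q. p \<in> \<rat> \<and> q \<in> \<rat> \<and> p < f i x \<and> f i x < q \<and> {p<..<q} \<subseteq> U i" if i: "i \<in> S" for i
  proof -
    have "open (U i)" "f i x \<in> U i" using U(2,3) i by (auto simp: e PiE_def Pi_def)
    then obtain d where d: "d > 0" "ball (f i x) d \<subseteq> U i" using openE by blast
    obtain p where p: "p \<in> \<rat>" "f i x - d < p" "p < f i x"
      using Rats_dense_in_real[of "f i x - d" "f i x"] d(1) by auto
    obtain q where q: "q \<in> \<rat>" "f i x < q" "q < f i x + d"
      using Rats_dense_in_real[of "f i x" "f i x + d"] d(1) by auto
    have "{p<..<q} \<subseteq> ball (f i x) d" using p q by (auto simp: dist_real_def)
    then show ?thesis using p q d(2) by blast
  qed
  then obtain p q where pq: "\<And>i. i \<in> S \<Longrightarrow>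
      p i \<in> \<rat> \<and> q i \<in> \<rat> \<and> p i < f i x \<and> f i x < q i \<and> {p i<..<q i} \<subseteq> U i"
    by metis
  obtain K where K: "set K = {i \<in> S. U i \<noteq> topspace euclideanreal}"
    using finite_list[OF U(1)] by blast
  define l where "l = map (\<lambda>i. (i, p i, q i)) K"
  have "l \<in> lists (S \<times> \<rat> \<times> \<rat>)" using pq K by (auto simp: l_def)
  moreover have "x \<in> rational_box X f l" using x pq K by (auto simp: l_def rational_box_def)
  moreover have "e z \<in> B" if z: "z \<in> rational_box X f l" for z
  proof -
    have "f i z \<in> U i" if "i \<in> S" for i
    proof (cases "i \<in> set K")
      case True
      then have "f i z \<in> {p i<..<q i}" using z by (auto simp: l_def rational_box_def)
      then show ?thesis using pq that by blast
    next
      case False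
      then show ?thesis using K that by auto
    qed
    then have "e z \<in> Pi\<^sub>E S U" by (auto simp: e)
    then show ?thesis using U(4) V(2) z by (auto simp: rational_box_def)
  qed
  ultimately show ?thesis by blast
qed

text \<open>The diagonal map \<open>e\<close> sends \<open>X\<close> onto a subspace
  \<open>Y\<close> of a product of lines, so \<open>Y\<close> is a Tychonov image of
  \<open>X\<close>. Each member of a small local \<pi>-base at \<open>e x\<close> is replaced by a
  box whose image lies in it, which leaves a statement about \<open>X\<close> alone.\<close>

lemma local_pi_base_of_boxes:
  fixes X :: "'a topology" and f :: "'i \<Rightarrow> 'a \<Rightarrow> real"
  assumes f: "\<And>i. i \<in> S \<Longrightarrow> continuous_map X euclideanreal (f i)" and x: "x \<in> topspace X"
  obtains L where "L \<subseteq> lists (S \<times> \<rat> \<times> \<rat>)" "|L| \<le>o proj_pi_char X"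
    "\<And>l. l \<in> L \<Longrightarrow> rational_box X f l \<noteq> {}"
    "\<And>i. i \<in> S \<Longrightarrow> 0 < f i x \<Longrightarrow> \<exists>l\<in>L. rational_box X f l \<subseteq> {z \<in> topspace X. 0 < f i z}"
proof -
  define e where "e = (\<lambda>x. \<lambda>i\<in>S. f i x)"
  define Y where "Y = subtopology (product_topology (\<lambda>_. euclideanreal) S) (e ` topspace X)"
  have tY: "topspace Y = e ` topspace X"
    by (auto simp: Y_def e_def)
  have ce: "continuous_map X Y e"
    unfolding Y_def continuous_map_in_subtopology continuous_map_componentwise
    using f by (auto simp: e_def)
  have "Tychonov_space Y"
    unfolding Tychonov_space_def Y_def
    by (intro conjI completely_regular_space_subtopology Hausdorff_space_subtopology)
      (auto simp: completely_regular_space_product_topology Hausdorff_space_product_topology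
         metrizable_imp_completely_regular_space metrizable_space_euclidean)
  moreover have "continuous_image_of Y X"
    unfolding continuous_image_of_def using ce tY by blast
  ultimately have "pi_char Y \<le>o proj_pi_char X" by (rule pi_char_le_proj_pi_char)
  moreover have "pi_char_at (e x) Y \<le>o pi_char Y" using x tY by (intro pi_char_upper) blast
  moreover obtain \<B> where B: "local_pi_base Y (e x) \<B>" "|\<B>| \<le>o pi_char_at (e x) Y"
    using pi_char_at_attained[of Y "e x"] by blast
  ultimately have card: "|\<B>| \<le>o proj_pi_char X" by (meson ordLeq_transitive)
  \<comment> \<open>As \<open>Y\<close> is exactly the image, \<open>D\<close> contains some
    \<open>e z\<close>, and a box around \<open>z\<close> is non-empty.\<close>
  have "\<exists>l \<in> lists (S \<times> \<rat> \<times> \<rat>). rational_box X f l \<noteq> {} \<and> e ` rational_box X f l \<subseteq> D" if "D \<in> \<B>" for D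
  proof -
    have D: "openin Y D" "D \<noteq> {}" using B(1) that unfolding local_pi_base_def by blast+
    then obtain y where y: "y \<in> D" by blast
    then have "y \<in> e ` topspace X" using openin_subset[OF D(1)] tY by blast
    then obtain z where z: "z \<in> topspace X" "e z \<in> D" using y by auto
    show ?thesis using rational_box_base[OF z(1) D(1)[unfolded Y_def] e_def z(2)] by blast
  qed
  then obtain b where b: "\<And>D. D \<in> \<B> \<Longrightarrow> b D \<in> lists (S \<times> \<rat> \<times> \<rat>)"
      "\<And>D. D \<in> \<B> \<Longrightarrow> rational_box X f (b D) \<noteq> {}"
      "\<And>D. D \<in> \<B> \<Longrightarrow> e ` rational_box X f (b D) \<subseteq> D"
    by metis
  show ?thesis
  proof (rule that[of "b ` \<B>"])
    show "b ` \<B> \<subseteq> lists (S \<times> \<rat> \<times> \<rat>)" using b(1) by blast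
    show "|b ` \<B>| \<le>o proj_pi_char X" by (rule ordLeq_transitive[OF card_of_image card])
    show "rational_box X f l \<noteq> {}" if "l \<in> b ` \<B>" for l using that b(2) by blast
    fix i assume i: "i \<in> S" "0 < f i x"
    \<comment> \<open>The cozero set of \<open>f i\<close> is the preimage under \<open>e\<close> of
      this open half-space, a neighbourhood of \<open>e x\<close>.\<close>
    let ?U = "{y \<in> topspace Y. y i \<in> {0<..}}"
    have "continuous_map Y euclideanreal (\<lambda>y. y i)"
      unfolding Y_def using i(1)
      by (intro continuous_map_from_subtopology continuous_map_product_projection)
    then have "openin Y ?U" by (rule openin_continuous_map_preimage) simp
    moreover have "e x \<in> ?U" using x i tY by (simp add: e_def)
    ultimately obtain D where D: "D \<in> \<B>" "D \<subseteq> ?U"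
      using B(1) unfolding local_pi_base_def by meson
    have "rational_box X f (b D) \<subseteq> {z \<in> topspace X. 0 < f i z}"
    proof
      fix z assume z: "z \<in> rational_box X f (b D)"
      then have "e z i \<in> {0<..}" using b(3)[OF D(1)] D(2) by blast
      then show "z \<in> {z \<in> topspace X. 0 < f i z}"
        using z i(1) by (simp add: e_def rational_box_def)
    qed
    then show "\<exists>l\<in>b ` \<B>. rational_box X f l \<subseteq> {z \<in> topspace X. 0 < f i z}"
      using D(1) by blast
  qed
qed

text \<open>Too many indices at \<open>x\<close> would contain a family \<open>S\<close> in which
  small subfamilies are bounded. A local \<pi>-base of boxes over \<open>S\<close> then uses only
  indices before some \<open>a\<close> in \<open>S\<close>, yet one of its boxes fits into the
  cozero set of \<open>f a\<close>, against \<open>ind\<close>.\<close>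

lemma order_of_independent_sequence:
  fixes X :: "'a topology" and f :: "'i \<Rightarrow> 'a \<Rightarrow> real"
  assumes wo: "Well_order r"
    and f: "\<And>i. i \<in> Field r \<Longrightarrow> continuous_map X euclideanreal (f i)"
    and ind: "\<And>i l. i \<in> Field r \<Longrightarrow> l \<in> lists (underS r i \<times> \<rat> \<times> \<rat>) \<Longrightarrow> rational_box X f l \<noteq> {} \<Longrightarrow>
      \<not> rational_box X f l \<subseteq> {z \<in> topspace X. 0 < f i z}"
    and x: "x \<in> topspace X"
  shows "|{i \<in> Field r. 0 < f i x}| \<le>o proj_pi_char X"
proof (rule ccontr)
  let ?k = "proj_pi_char X"
  note k = Cinfinite_proj_pi_char[of X]
  assume "\<not> ?thesis"
  then obtain S where S: "S \<subseteq> {i \<in> Field r. 0 < f i x}"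
      "\<And>T. T \<subseteq> S \<Longrightarrow> |T| \<le>o ?k \<Longrightarrow> \<exists>a\<in>S. T \<subseteq> underS r a"
    using subset_with_small_subsets_bounded[OF wo _ k, of "{i \<in> Field r. 0 < f i x}"] by blast
  have fS: "\<And>i. i \<in> S \<Longrightarrow> continuous_map X euclideanreal (f i)" using f S(1) by blast
  obtain L where L: "L \<subseteq> lists (S \<times> \<rat> \<times> \<rat>)" "|L| \<le>o ?k"
      "\<And>l. l \<in> L \<Longrightarrow> rational_box X f l \<noteq> {}"
      "\<And>i. i \<in> S \<Longrightarrow> 0 < f i x \<Longrightarrow> \<exists>l\<in>L. rational_box X f l \<subseteq> {z \<in> topspace X. 0 < f i z}"
    using fS x by (rule local_pi_base_of_boxes) blast+
  \<comment> \<open>All indices used by the boxes. Each list contributes finitely many, so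
    \<open>?T\<close> is small enough to be bounded in \<open>S\<close>.\<close>
  let ?T = "\<Union>l\<in>L. fst ` set l"
  have "?T \<subseteq> S" using L(1) by fastforce
  moreover have "|?T| \<le>o ?k"
    using k L(2) finite_ordLeq_Cinfinite[OF k]
    by (intro card_of_UNION_ordLeq_infinite_Field) (auto simp: cinfinite_def)
  ultimately have "\<exists>a\<in>S. ?T \<subseteq> underS r a" by (rule S(2))
  then obtain a where a: "a \<in> S" "?T \<subseteq> underS r a" by (elim bexE)
  then obtain l where l: "l \<in> L" "rational_box X f l \<subseteq> {z \<in> topspace X. 0 < f a z}"
    using L(4) S(1) by blast
  have "l \<in> lists (underS r a \<times> \<rat> \<times> \<rat>)"
  proof
    show "\<forall>t\<in>set l. t \<in> underS r a \<times> \<rat> \<times> \<rat>"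
    proof
      fix t assume t: "t \<in> set l"
      then have "t \<in> S \<times> \<rat> \<times> \<rat>" using L(1) l(1) by auto
      moreover have "fst t \<in> underS r a" using t l(1) a(2) by blast
      ultimately show "t \<in> underS r a \<times> \<rat> \<times> \<rat>" by auto
    qed
  qed
  then show False using ind[of a l] a(1) S(1) l L(3) by blast
qed

section \<open>Open sets of homogeneous \<pi>-weight\<close>

text \<open>For non-empty open \<open>G\<close> this makes \<open>|\<P>|\<close> the \<pi>-weight of
  \<open>G\<close> and of each non-empty open \<open>H\<close> inside it: the members of
  \<open>\<P>\<close> contained in \<open>H\<close> form a \<pi>-base of \<open>H\<close>, which
  gives the other inequality.\<close>

definition pi_weight_homogeneous :: "'a topology \<Rightarrow> 'a set \<Rightarrow> 'a set set \<Rightarrow> bool"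
  where "pi_weight_homogeneous X G \<P> \<longleftrightarrow> pi_base (subtopology X G) \<P> \<and>
    (\<forall>H \<Q>. openin X H \<and> H \<noteq> {} \<and> H \<subseteq> G \<and> pi_base (subtopology X H) \<Q> \<longrightarrow> |\<P>| \<le>o |\<Q>| )"

lemma pi_base_open_subtopology:
  assumes "openin X G"
  shows "pi_base (subtopology X G) \<B> \<longleftrightarrow>
    (\<forall>B\<in>\<B>. openin X B \<and> B \<noteq> {} \<and> B \<subseteq> G) \<and>
    (\<forall>U. openin X U \<and> U \<noteq> {} \<and> U \<subseteq> G \<longrightarrow> (\<exists>B\<in>\<B>. B \<subseteq> U))"
  unfolding pi_base_def openin_open_subtopology[OF assms] by blast

text \<open>Cardinals are well-founded. A \<pi>-base of least size among those of all non-empty open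
  subsets of \<open>U\<close> is homogeneous, as open subsets of \<open>G\<close> took part in the
  comparison.\<close>

lemma exists_pi_weight_homogeneous:
  assumes U: "openin X U" "U \<noteq> {}"
  obtains G \<P> where "openin X G" "G \<noteq> {}" "G \<subseteq> U" "pi_weight_homogeneous X G \<P>"
proof -
  let ?P = "\<lambda>H \<P>. openin X H \<and> H \<noteq> {} \<and> H \<subseteq> U \<and> pi_base (subtopology X H) \<P>"
  let ?R = "{r. \<exists>H \<P>. ?P H \<P> \<and> r = |\<P>| }"
  have "pi_base (subtopology X U) {V. openin (subtopology X U) V \<and> V \<noteq> {}}"
    by (auto simp: pi_base_def)
  then have "|{V. openin (subtopology X U) V \<and> V \<noteq> {}}| \<in> ?R" using U by blast
  then obtain r where r: "r \<in> ?R" "\<And>s. (s, r) \<in> ordLess \<Longrightarrow> s \<notin> ?R"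
    by (rule wfE_min[OF wf_ordLess]) blast
  then obtain G \<P> where G: "?P G \<P>" "r = |\<P>|" by blast
  have "|\<P>| \<le>o |\<Q>|" if "openin X H \<and> H \<noteq> {} \<and> H \<subseteq> G \<and> pi_base (subtopology X H) \<Q>" for H \<Q>
  proof -
    have "?P H \<Q>" using that G(1) by blast
    then have "|\<Q>| \<in> ?R" by blast
    then have "\<not> |\<Q>| <o |\<P>|" using r(2) G(2) by blast
    then show ?thesis
      using not_ordLess_iff_ordLeq[OF card_of_Well_order card_of_Well_order] by blast
  qed
  then have "pi_weight_homogeneous X G \<P>"
    using G(1) unfolding pi_weight_homogeneous_def by blast
  then show ?thesis using that G(1) by blast
qed

text \<open>Complete regularity gives \<open>f\<close> vanishing at a point of \<open>H\<close> and
  equal to 1 off \<open>H\<close>; then \<open>1 - f\<close> is as wanted.\<close>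

lemma exists_continuous_positive_inside:
  assumes X: "completely_regular_space X" and H: "openin X H" "H \<noteq> {}"
  obtains g where "continuous_map X euclideanreal g"
    "{z \<in> topspace X. 0 < g z} \<subseteq> H" "{z \<in> topspace X. 0 < g z} \<noteq> {}"
proof -
  obtain x where x: "x \<in> H" "x \<in> topspace X" using H openin_subset by blast
  have "closedin X (topspace X - H)" using H(1) by blast
  moreover have "x \<in> topspace X - (topspace X - H)" using x by blast
  ultimately obtain f :: "'a \<Rightarrow> real" where f: "continuous_map X (top_of_set {0..1}) f" "f x = 0"
      "f ` (topspace X - H) \<subseteq> {1}"
    using X unfolding completely_regular_space_def by meson
  show ?thesis
  proof (rule that[of "\<lambda>z. 1 - f z"])
    have "continuous_map X euclideanreal f" using f(1) by (simp add: continuous_map_in_subtopology)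
    then show "continuous_map X euclideanreal (\<lambda>z. 1 - f z)"
      by (intro continuous_map_diff) auto
    show "{z \<in> topspace X. 0 < 1 - f z} \<subseteq> H"
    proof
      fix z assume z: "z \<in> {z \<in> topspace X. 0 < 1 - f z}"
      show "z \<in> H"
      proof (rule ccontr)
        assume "z \<notin> H"
        then have "f z = 1" using f(3) z by blast
        then show False using z by simp
      qed
    qed
    show "{z \<in> topspace X. 0 < 1 - f z} \<noteq> {}" using x f(2) by auto
  qed
qed

text \<open>A small \<open>\<P>\<close> has small order by itself. Otherwise each member is shrunk
  to a cozero set, so that the sets still form a \<pi>-base, and independence of the functions
  bounds their order.\<close>

lemma pi_weight_homogeneous_imp_pi_base:
  fixes X :: "'a topology"
  assumes X: "completely_regular_space X" and G: "openin X G"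
    and hom: "pi_weight_homogeneous X G \<P>"
  shows "\<exists>\<B>. pi_base (subtopology X G) \<B> \<and> order_at_most X \<B> (proj_pi_char X)"
proof (cases "|\<P>| \<le>o proj_pi_char X")
  case True
  have "|{B \<in> \<P>. x \<in> B}| \<le>o proj_pi_char X" for x
    by (rule ordLeq_transitive[OF card_of_mono1 True]) blast
  then show ?thesis using hom unfolding pi_weight_homogeneous_def order_at_most_def by blast
next
  case False
  let ?k = "proj_pi_char X" and ?r = "|\<P>|"
  let ?U = "\<lambda>g. {z \<in> topspace X. 0 < g z}"
  let ?L = "\<lambda>i. lists (underS ?r i \<times> \<rat> \<times> \<rat>) :: ('a set \<times> real \<times> real) list set"
  note k = Cinfinite_proj_pi_char[of X]
  have k_less: "?k <o ?r"
    by (rule iffD1[OF not_ordLeq_iff_ordLess False])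
      (use k card_order_on_well_order_on card_of_Well_order in blast)+
  have wo: "Well_order ?r" by (rule card_of_Well_order)
  have Pi: "pi_base (subtopology X G) \<P>"
    and least: "\<And>H \<Q>. openin X H \<Longrightarrow> H \<noteq> {} \<Longrightarrow> H \<subseteq> G \<Longrightarrow> pi_base (subtopology X H) \<Q> \<Longrightarrow> ?r \<le>o |\<Q>|"
    using hom unfolding pi_weight_homogeneous_def by blast+
  have few: "|?L i| <o ?r" if i: "i \<in> \<P>" for i
  proof -
    have u: "|underS ?r i| <o ?r"
      by (rule card_of_underS) (use i in \<open>simp_all add: card_of_card_order_on Field_card_of\<close>)
    \<comment> \<open>Stated for \<open>p\<close> over any type: it is applied to \<open>?k\<close>
      if the segment is small, and otherwise to the size of the segment itself, which is infinite
      because it is at least \<open>?k\<close>.\<close>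
    have *: "|?L i| \<le>o p" if p: "Cinfinite p" "|underS ?r i| \<le>o p" for p :: "'c rel"
    proof -
      have "|\<rat> :: real set| \<le>o p"
        using iffD1[OF countable_card_le_natLeq countable_rat] natLeq_ordLeq_cinfinite[OF p(1)]
        by (rule ordLeq_transitive)
      then show ?thesis
        using p by (intro card_of_lists_ordLeq card_of_Times_ordLeq_infinite_Field)
          (auto simp: cinfinite_def)
    qed
    show ?thesis
    proof (cases "|underS ?r i| \<le>o ?k")
      case True
      show ?thesis by (rule ordLeq_ordLess_trans[OF *[OF k True] k_less])
    next
      case False
      then have "?k \<le>o |underS ?r i|"
        using ordLeq_total[OF card_of_Well_order card_order_on_well_order_on[OF conjunct2[OF k]],
          of "underS ?r i"] by blast
      then have "Cinfinite |underS ?r i|"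
        using cinfinite_mono[OF _ conjunct1[OF k]] card_of_Card_order[of "underS ?r i"] by (intro conjI)
      then show ?thesis
        by (rule ordLeq_ordLess_trans[OF * u]) (rule ordLeq_refl[OF card_of_Card_order])
    qed
  qed
  \<comment> \<open>The members of \<open>\<P>\<close> index themselves through the well-order
    \<open>?r\<close>. Outside \<open>\<P>\<close> the condition is vacuous, so the recursion can
    run over the whole type.\<close>
  define P where "P = (\<lambda>f i g. i \<in> \<P> \<longrightarrow> continuous_map X euclideanreal g \<and> ?U g \<subseteq> i \<and> ?U g \<noteq> {} \<and>
    (\<forall>l\<in>?L i. rational_box X f l \<noteq> {} \<longrightarrow> \<not> rational_box X f l \<subseteq> ?U g))"
  have "\<exists>f. \<forall>i. P f i (f i)"
  proof (rule dependent_wf_choice)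
    show "wf (?r - Id)" using wo unfolding well_order_on_def by blast
    fix f g :: "'a set \<Rightarrow> 'a \<Rightarrow> real" and i h
    assume eq: "\<And>z. (z, i) \<in> ?r - Id \<Longrightarrow> f z = g z"
    have "rational_box X f l = rational_box X g l" if "l \<in> ?L i" for l
    proof (rule rational_box_cong)
      fix j assume "j \<in> fst ` set l"
      then have "j \<in> underS ?r i" using that by auto
      then show "f j = g j" by (intro eq) (auto simp: underS_def)
    qed
    then show "P f i h = P g i h" unfolding P_def by simp
  next
    fix i f assume IH: "\<And>j. (j, i) \<in> ?r - Id \<Longrightarrow> P f j (f j)"
    show "\<exists>g. P f i g"
    proof (cases "i \<in> \<P>")
      case False
      then show ?thesis by (simp add: P_def)
    next
      case i: True
      then have oi: "openin X i" "i \<noteq> {}" "i \<subseteq> G"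
        using Pi unfolding pi_base_open_subtopology[OF G] by blast+
      have cont: "continuous_map X euclideanreal (f j)" if "j \<in> underS ?r i" for j
      proof -
        have "(j, i) \<in> ?r - Id" using that by (auto simp: underS_def)
        moreover from this have "j \<in> \<P>" by (metis DiffD1 Field_card_of FieldI1)
        ultimately show ?thesis using IH[of j] unfolding P_def by blast
      qed
      \<comment> \<open>The boxes from earlier functions that lie in \<open>i\<close>. They are
        fewer than any \<pi>-base of \<open>i\<close> has members, so some non-empty open
        \<open>H\<close> inside \<open>i\<close> contains none of them.\<close>
      define \<W> where "\<W> = {W \<in> rational_box X f ` ?L i. W \<noteq> {} \<and> W \<subseteq> i}"
      have "|\<W>| \<le>o |?L i|"
        unfolding \<W>_def
        by (rule ordLeq_transitive[OF card_of_mono1 card_of_image]) blast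
      then have "|\<W>| <o ?r" using few[OF i] by (rule ordLeq_ordLess_trans)
      then have "\<not> pi_base (subtopology X i) \<W>"
        using least[OF oi, of \<W>] not_ordLess_ordLeq[of "|\<W>|" ?r] by blast
      moreover have "openin X W \<and> W \<noteq> {} \<and> W \<subseteq> i" if "W \<in> \<W>" for W
      proof -
        from that obtain l where l: "l \<in> ?L i" "W = rational_box X f l"
          unfolding \<W>_def by blast
        have "openin X W"
          unfolding l(2) by (rule openin_rational_box) (use l(1) in \<open>auto intro!: cont\<close>)
        then show ?thesis using that unfolding \<W>_def by blast
      qed
      ultimately obtain H where H: "openin X H" "H \<noteq> {}" "H \<subseteq> i" "\<And>W. W \<in> \<W> \<Longrightarrow> \<not> W \<subseteq> H"
        unfolding pi_base_open_subtopology[OF oi(1)] by blast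
      obtain g where g: "continuous_map X euclideanreal g" "?U g \<subseteq> H" "?U g \<noteq> {}"
        using exists_continuous_positive_inside[OF X H(1,2)] by blast
      have "\<not> rational_box X f l \<subseteq> ?U g" if "l \<in> ?L i" "rational_box X f l \<noteq> {}" for l
      proof
        assume *: "rational_box X f l \<subseteq> ?U g"
        then have sub: "rational_box X f l \<subseteq> H" using g(2) by (rule subset_trans)
        then have "rational_box X f l \<in> \<W>" using that H(3) unfolding \<W>_def by blast
        then show False using H(4) sub by blast
      qed
      then show ?thesis using g H(3) unfolding P_def by blast
    qed
  qed
  then obtain f where f: "\<And>i. P f i (f i)" by blast
  have order: "|{i \<in> \<P>. 0 < f i x}| \<le>o ?k" if x: "x \<in> topspace X" for x
  proof -
    have "continuous_map X euclideanreal (f i)" if "i \<in> Field ?r" for i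
      using f[of i] that by (simp add: P_def Field_card_of)
    moreover have "\<not> rational_box X f l \<subseteq> ?U (f i)"
      if "i \<in> Field ?r" "l \<in> ?L i" "rational_box X f l \<noteq> {}" for i l
      using f[of i] that unfolding P_def Field_card_of by blast
    ultimately have "|{i \<in> Field ?r. 0 < f i x}| \<le>o ?k"
      using x by (rule order_of_independent_sequence[OF wo])
    then show ?thesis by (simp add: Field_card_of)
  qed
  have "pi_base (subtopology X G) ((\<lambda>i. ?U (f i)) ` \<P>)"
    unfolding pi_base_open_subtopology[OF G]
  proof (intro conjI ballI allI impI)
    fix B assume "B \<in> (\<lambda>i. ?U (f i)) ` \<P>"
    then obtain i where i: "i \<in> \<P>" "B = ?U (f i)" by blast
    have "i \<subseteq> G" using i(1) Pi unfolding pi_base_open_subtopology[OF G] by blast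
    then show "B \<noteq> {}" "B \<subseteq> G" using f[of i] i unfolding P_def by blast+
    have "openin X {z \<in> topspace X. f i z \<in> {0<..}}"
      using f[of i] i(1) by (intro openin_continuous_map_preimage[where Y = euclideanreal]) (auto simp: P_def)
    then show "openin X B" using i(2) by simp
  next
    fix V assume "openin X V \<and> V \<noteq> {} \<and> V \<subseteq> G"
    then obtain i where i: "i \<in> \<P>" "i \<subseteq> V" using Pi unfolding pi_base_open_subtopology[OF G] by blast
    then have "?U (f i) \<subseteq> V" using f[of i] unfolding P_def by blast
    then show "\<exists>B\<in>(\<lambda>i. ?U (f i)) ` \<P>. B \<subseteq> V" using i(1) by (rule bexI[OF _ imageI])
  qed
  moreover have "order_at_most X ((\<lambda>i. ?U (f i)) ` \<P>) ?k"
    unfolding order_at_most_def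
  proof
    fix x assume x: "x \<in> topspace X"
    \<comment> \<open>Different indices may give the same cozero set, so the members at
      \<open>x\<close> are bounded as an image of the indices.\<close>
    have "{B \<in> (\<lambda>i. ?U (f i)) ` \<P>. x \<in> B} \<subseteq> (\<lambda>i. ?U (f i)) ` {i \<in> \<P>. 0 < f i x}" by auto
    then show "|{B \<in> (\<lambda>i. ?U (f i)) ` \<P>. x \<in> B}| \<le>o ?k"
      by (rule ordLeq_transitive[OF card_of_mono1 ordLeq_transitive[OF card_of_image order[OF x]]])
  qed
  ultimately show ?thesis by blast
qed

section \<open>Gluing along a maximal disjoint family\<close>

lemma exists_maximal_disjoint_family:
  obtains M where "M \<subseteq> A" "pairwise disjnt M"
    "\<And>G. G \<in> A \<Longrightarrow> G \<noteq> {} \<Longrightarrow> \<exists>H\<in>M. \<not> disjnt G H"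
proof -
  let ?F = "{M. M \<subseteq> A \<and> pairwise disjnt M}"
  have "\<exists>M\<in>?F. \<forall>N\<in>?F. M \<subseteq> N \<longrightarrow> N = M"
  proof (rule Zorn_Lemma, intro ballI)
    fix C assume "C \<in> chains ?F"
    then have C: "C \<subseteq> ?F" "chain\<^sub>\<subseteq> C" unfolding chains_def by auto
    have "pairwise disjnt (\<Union>C)"
      using C(1) by (intro pairwise_chain_Union[OF _ C(2)]) blast
    then show "\<Union>C \<in> ?F" using C(1) by blast
  qed
  then obtain M where M: "M \<in> ?F" "\<forall>N\<in>?F. M \<subseteq> N \<longrightarrow> N = M" by (rule bexE)
  have "\<exists>H\<in>M. \<not> disjnt G H" if G: "G \<in> A" "G \<noteq> {}" for G
  proof (rule ccontr)
    assume neg: "\<not> ?thesis"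
    then have "insert G M \<in> ?F" using M(1) G by (auto simp: pairwise_insert disjnt_sym)
    \<comment> \<open>By maximality \<open>G\<close> is already in \<open>M\<close>, hence disjoint
      from itself, which a non-empty set cannot be.\<close>
    from bspec[OF M(2) this] have "G \<in> M" by blast
    then show False using neg G(2) by (auto simp: disjnt_def)
  qed
  then show ?thesis using that M(1) by blast
qed

text \<open>Homogeneous sets lie inside every non-empty open set, so by maximality the union of
  \<open>M\<close> is dense and the local \<pi>-bases together form one of \<open>X\<close>.
  Disjointness keeps the order, since a point meets the \<pi>-base of at most one member of
  \<open>M\<close>.\<close>

lemma exists_pi_base_order_proj_pi_char:
  fixes X :: "'a topology"
  assumes X: "completely_regular_space X"
  shows "\<exists>\<B>. pi_base X \<B> \<and> order_at_most X \<B> (proj_pi_char X)"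
proof -
  define A where "A = {G. openin X G \<and> (\<exists>\<P>. pi_weight_homogeneous X G \<P>)}"
  obtain M where M: "M \<subseteq> A" "pairwise disjnt M"
      "\<And>G. G \<in> A \<Longrightarrow> G \<noteq> {} \<Longrightarrow> \<exists>H\<in>M. \<not> disjnt G H"
    by (rule exists_maximal_disjoint_family[of A]) blast
  have "\<exists>\<B>. pi_base (subtopology X G) \<B> \<and> order_at_most X \<B> (proj_pi_char X)" if "G \<in> M" for G
    using pi_weight_homogeneous_imp_pi_base[OF X] that M(1) unfolding A_def by blast
  then obtain b where b: "\<And>G. G \<in> M \<Longrightarrow> pi_base (subtopology X G) (b G)"
      "\<And>G. G \<in> M \<Longrightarrow> order_at_most X (b G) (proj_pi_char X)"
    by metis
  have in_G: "openin X B \<and> B \<noteq> {} \<and> B \<subseteq> G" if "G \<in> M" "B \<in> b G" for G B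
  proof -
    have "openin X G" using that(1) M(1) unfolding A_def by blast
    then show ?thesis using b(1)[OF that(1)] that(2) by (simp add: pi_base_open_subtopology)
  qed
  have "pi_base X (\<Union>G\<in>M. b G)"
    unfolding pi_base_def
  proof (intro conjI ballI allI impI)
    show "openin X B" "B \<noteq> {}" if "B \<in> (\<Union>G\<in>M. b G)" for B using that in_G by blast+
    fix U assume U: "openin X U \<and> U \<noteq> {}"
    obtain G \<P> where G: "openin X G" "G \<noteq> {}" "G \<subseteq> U" "pi_weight_homogeneous X G \<P>"
      using U exists_pi_weight_homogeneous by blast
    then obtain H where H: "H \<in> M" "\<not> disjnt G H" using M(3)[of G] unfolding A_def by blast
    have oH: "openin X H" using H(1) M(1) unfolding A_def by blast
    then have "openin X (G \<inter> H)" "G \<inter> H \<noteq> {}" "G \<inter> H \<subseteq> H"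
      using G(1) H(2) by (auto simp: disjnt_def)
    then obtain B where "B \<in> b H" "B \<subseteq> G \<inter> H"
      using b(1)[OF H(1)] unfolding pi_base_open_subtopology[OF oH] by meson
    then show "\<exists>B\<in>(\<Union>G\<in>M. b G). B \<subseteq> U" using H(1) G(3) by blast
  qed
  moreover have "|{B \<in> (\<Union>G\<in>M. b G). x \<in> B}| \<le>o proj_pi_char X" if x: "x \<in> topspace X" for x
  proof (cases "\<exists>G\<in>M. x \<in> G")
    case True
    then obtain G where G: "G \<in> M" "x \<in> G" by blast
    have "{B \<in> (\<Union>G\<in>M. b G). x \<in> B} \<subseteq> {B \<in> b G. x \<in> B}"
    proof
      fix B assume "B \<in> {B \<in> (\<Union>G\<in>M. b G). x \<in> B}"
      then obtain H where H: "H \<in> M" "B \<in> b H" "x \<in> B" by blast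
      then have "x \<in> H" using in_G by blast
      then have "H = G" using M(2) G H(1) by (auto simp: pairwise_def disjnt_iff)
      then show "B \<in> {B \<in> b G. x \<in> B}" using H by blast
    qed
    moreover have "|{B \<in> b G. x \<in> B}| \<le>o proj_pi_char X"
      using b(2)[OF G(1)] x unfolding order_at_most_def by blast
    ultimately show ?thesis by (rule ordLeq_transitive[OF card_of_mono1])
  next
    case False
    then have none: "{B \<in> (\<Union>G\<in>M. b G). x \<in> B} = {}" using in_G by blast
    show ?thesis
      unfolding none by (rule finite_ordLeq_Cinfinite[OF Cinfinite_proj_pi_char finite.emptyI])
  qed
  ultimately show ?thesis unfolding order_at_most_def by blast
qed

theorem theorem2:
  fixes X :: "'a topology"
  assumes "Tychonov_space X"
  shows "pi_sw X \<le>o proj_pi_char X \<and>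
    (proj_pi_char X \<le>o natLeq \<longrightarrow>
      (\<exists>\<B>. pi_base X \<B> \<and> (\<forall>x\<in>topspace X. countable {B\<in>\<B>. x \<in> B})))"
proof -
  obtain \<B> where B: "pi_base X \<B>" "order_at_most X \<B> (proj_pi_char X)"
    using exists_pi_base_order_proj_pi_char assms unfolding Tychonov_space_def by blast
  show ?thesis
  proof (intro conjI impI exI ballI)
    show "pi_sw X \<le>o proj_pi_char X" by (rule pi_sw_least[OF B(1) Cinfinite_proj_pi_char B(2)])
    show "pi_base X \<B>" by (rule B(1))
    fix x assume le: "proj_pi_char X \<le>o natLeq" and x: "x \<in> topspace X"
    have "|{B \<in> \<B>. x \<in> B}| \<le>o proj_pi_char X"
      using B(2) x unfolding order_at_most_def by (rule bspec)
    then show "countable {B \<in> \<B>. x \<in> B}"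
      unfolding countable_card_le_natLeq using le by (rule ordLeq_transitive)
  qed
qed

end
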